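(* There is a universal constant $\mathcal{C}>0$ such that the following holds. Let $m\ge 1$, let $X\subseteq\mathbb{R}^m$ be a set with (finite) doubling constant $\lambda_X$, let $p\in\mathbb{R}^m$ with $p\notin X$, and let $k\ge 1$ be an integer with $k\ge \mathcal{C}\log_2(\lambda_X)$. Let $T:\mathbb{R}^m\to\mathbb{R}^k$ be a Gaussian random projection. Then $$\mathrm{Prob}\big(T(p)\notin T(X)\big)=1.$$
   Context: A Gaussian random projection $T:\mathbb{R}^m\to\mathbb{R}^k$ is the random linear map given by a $k\times m$ matrix whose entries are sampled independently from $\mathcal{N}(0,1)$. For a set $X\subseteq\mathbb{R}^m$ with the Euclidean metric, a closed ball in $X$ is a set $B_X(x,r)=\{y\in X : \|x-y\|\le r\}$ with $x\in X$, $r>0$. The doubling constant $\lambda_X$ is the smallest number such that every closed ball in $X$ can be covered by at most $\lambda_X$ closed balls in $X$ of half the radius; $\log_2\lambda_X$ is the doubling dimension of $X$. $T(X)=\{T(x): x\in X\}$. *)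

theory Defs
  imports "HOL-Probability.Probability" "HOL-Library.Extended_Nat"
begin

text \<open>
  The constant in the theorem must be uniform in the dimensions, so the dimensions are natural
  numbers rather than index types: a vector in \<open>\<real>\<^sup>n\<close> is an extensional
  function on \<open>{..<n}\<close>, as in \<^const>\<open>PiM\<close>.
\<close>

definition Rn :: "nat \<Rightarrow> (nat \<Rightarrow> real) set" where
  "Rn n = extensional {..<n}"

definition eucl_dist :: "nat \<Rightarrow> (nat \<Rightarrow> real) \<Rightarrow> (nat \<Rightarrow> real) \<Rightarrow> real" where
  "eucl_dist n x y = L2_set (\<lambda>i. x i - y i) {..<n}"

lemma Metric_space_eucl_dist:
  assumes "X \<subseteq> Rn n"
  shows "Metric_space X (eucl_dist n)"
proof
  fix x y
  show "0 \<le> eucl_dist n x y" by (simp add: eucl_dist_def)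
  show "eucl_dist n x y = eucl_dist n y x"
    by (simp add: eucl_dist_def L2_set_def power2_commute)
  assume "x \<in> X" "y \<in> X"
  then have "x \<in> extensional {..<n}" "y \<in> extensional {..<n}"
    using assms by (auto simp: Rn_def)
  then show "(eucl_dist n x y = 0) = (x = y)"
    by (auto simp: eucl_dist_def L2_set_eq_0_iff intro: extensionalityI)
next
  fix x y z
  show "eucl_dist n x z \<le> eucl_dist n x y + eucl_dist n y z"
    using L2_set_triangle_ineq[of "\<lambda>i. x i - y i" "\<lambda>i. y i - z i" "{..<n}"]
    by (simp add: eucl_dist_def)
qed

context Metric_space
begin

definition half_covers :: "nat \<Rightarrow> bool" where
  "half_covers L \<longleftrightarrow> (\<forall>x\<in>M. \<forall>r>0. \<exists>Y\<subseteq>M. finite Y \<and> card Y \<le> L \<and>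
     mcball x r \<subseteq> (\<Union>y\<in>Y. mcball y (r / 2)))"

text \<open>The infimum is attained when finite; it is \<open>\<infinity>\<close> if no number of balls suffices.\<close>

definition doubling_constant :: enat where
  "doubling_constant = (INF L\<in>{L. half_covers L}. enat L)"

end

text \<open>
  The joint law of the entries of a \<open>k \<times> m\<close> matrix of independent standard
  normal variables; the entry in row \<open>i\<close> and column \<open>j\<close> of \<open>A\<close> is \<open>A (i, j)\<close>.
\<close>

definition gaussian_matrix :: "nat \<Rightarrow> nat \<Rightarrow> (nat \<times> nat \<Rightarrow> real) measure" where
  "gaussian_matrix k m =
     PiM ({..<k} \<times> {..<m}) (\<lambda>_. density lborel (\<lambda>x. ennreal (std_normal_density x)))"

definition mat_apply :: "nat \<Rightarrow> nat \<Rightarrow> (nat \<times> nat \<Rightarrow> real) \<Rightarrow> (nat \<Rightarrow> real) \<Rightarrow> (nat \<Rightarrow> real)" where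
  "mat_apply k m A x = (\<lambda>i\<in>{..<k}. \<Sum>j<m. A (i, j) * x j)"

text \<open>
  Almost sure statements about \<^const>\<open>gaussian_matrix\<close> carry over to every probability space
  carrying independent standard normal entries \<open>Z (i, j)\<close>. The product measure is used
  in the theorem because a universal constant must not depend on the type of the sample space.
\<close>

lemma (in prob_space) AE_gaussian_matrix_imp_AE:
  fixes Z :: "nat \<times> nat \<Rightarrow> 'a \<Rightarrow> real"
  assumes "k \<ge> 1" "m \<ge> 1"
    and indep: "indep_vars (\<lambda>_. borel) Z ({..<k} \<times> {..<m})"
    and normal: "\<And>i j. i < k \<Longrightarrow> j < m \<Longrightarrow> distributed M lborel (Z (i, j)) std_normal_density"
    and AE: "AE A in gaussian_matrix k m. P A"
  shows "AE \<omega> in M. P (\<lambda>ij\<in>{..<k} \<times> {..<m}. Z ij \<omega>)"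
proof -
  let ?I = "{..<k} \<times> {..<m}"
  have I: "?I \<noteq> {}" using assms(1,2) by (auto simp: lessThan_empty_iff)
  have rv: "Z ij \<in> borel_measurable M" if "ij \<in> ?I" for ij
    using indep that by (auto simp: indep_vars_def)
  have law: "distr M borel (Z ij) = density lborel (\<lambda>x. ennreal (std_normal_density x))"
    if "ij \<in> ?I" for ij
  proof -
    have "distr M borel (Z ij) = distr M lborel (Z ij)" by (rule distr_cong) auto
    then show ?thesis
      using normal that by (auto simp: distributed_def)
  qed
  have "distr M (PiM ?I (\<lambda>_. borel)) (\<lambda>\<omega>. \<lambda>ij\<in>?I. Z ij \<omega>) = PiM ?I (\<lambda>ij. distr M borel (Z ij))"
    by (rule indep_vars_iff_distr_eq_PiM'[THEN iffD1, OF I rv indep])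
  also have "\<dots> = gaussian_matrix k m"
    unfolding gaussian_matrix_def by (rule PiM_cong) (simp_all add: law)
  finally have eq: "distr M (PiM ?I (\<lambda>_. borel)) (\<lambda>\<omega>. \<lambda>ij\<in>?I. Z ij \<omega>) = gaussian_matrix k m" .
  have "(\<lambda>\<omega>. \<lambda>ij\<in>?I. Z ij \<omega>) \<in> measurable M (PiM ?I (\<lambda>_. borel))"
    by (rule measurable_restrict) (rule rv)
  then show ?thesis
    by (rule AE_distrD) (unfold eq, rule AE)
qed

end

theory Submission imports Defs begin

text \<open>
  It suffices to show that almost surely \<open>A\<close> does not kill \<open>y - p\<close> for any \<open>y \<in> X\<close> with
  \<open>dist x0 y \<le> R\<close> and \<open>dist y p \<ge> \<delta>\<close>, for fixed \<open>R\<close> and \<open>\<delta>\<close>, and only on the event that all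
  entries of \<open>A\<close> are bounded by some fixed \<open>K\<close>: countably many such statements cover everything.
  On that event, if \<open>A (y - p) = 0\<close> and \<open>c\<close> is within \<open>\<epsilon>\<close> of \<open>y\<close>, then \<open>A (c - p)\<close> has
  entries of size \<open>O(\<epsilon>)\<close>, which has probability \<open>O(\<epsilon> ^ k)\<close>. Doubling gives \<open>L ^ n\<close> centres \<open>c\<close> for
  \<open>\<epsilon> = R / 2 ^ n\<close>, so the union bound \<open>O((L / 2 ^ k) ^ n)\<close> tends to 0 as soon as \<open>L < 2 ^ k\<close>.
\<close>

section \<open>Iterated halving of balls in a doubling space\<close>

context Metric_space
begin

text \<open>\<open>enat\<close> is well-ordered, so the infimum of a nonempty set belongs to it. The
  empty set has infimum \<infinity>, which the finite value excludes.\<close>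

lemma half_covers_doubling_constant:
  assumes "doubling_constant = enat L"
  shows "half_covers L"
proof -
  let ?S = "enat ` {L. half_covers L}"
  have "?S \<noteq> {}"
  proof
    assume "?S = {}"
    then have "doubling_constant = \<infinity>"
      unfolding doubling_constant_def by (simp only: Inf_empty top_enat_def)
    then show False using assms by simp
  qed
  then have "Inf ?S \<in> ?S"
    by (metis equals0I wellorder_InfI)
  then show ?thesis
    using assms by (auto simp: doubling_constant_def)
qed

text \<open>Each halving replaces every ball of the current cover by at most \<open>L\<close>
  smaller ones. The new centres lie in \<open>M\<close> again, so doubling can be reapplied to
  them.\<close>

lemma half_covers_iterate:
  assumes L: "half_covers L" and x: "x \<in> M" and r: "r > 0"
  shows "\<exists>Y\<subseteq>M. finite Y \<and> card Y \<le> L ^ n \<and> mcball x r \<subseteq> (\<Union>y\<in>Y. mcball y (r / 2 ^ n))"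
proof (induction n)
  case 0
  show ?case using x by (intro exI[of _ "{x}"]) auto
next
  case (Suc n)
  then obtain Y where Y: "Y \<subseteq> M" "finite Y" "card Y \<le> L ^ n"
    "mcball x r \<subseteq> (\<Union>y\<in>Y. mcball y (r / 2 ^ n))" by blast
  have "\<forall>y\<in>Y. \<exists>Z\<subseteq>M. finite Z \<and> card Z \<le> L \<and>
      mcball y (r / 2 ^ n) \<subseteq> (\<Union>z\<in>Z. mcball z (r / 2 ^ n / 2))"
    using L Y(1) r unfolding half_covers_def by (metis divide_pos_pos subsetD zero_less_numeral zero_less_power)
  then obtain Z where Z: "\<And>y. y \<in> Y \<Longrightarrow> Z y \<subseteq> M \<and> finite (Z y) \<and> card (Z y) \<le> L \<and>
      mcball y (r / 2 ^ n) \<subseteq> (\<Union>z\<in>Z y. mcball z (r / 2 ^ n / 2))"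
    by metis
  have "card (\<Union>y\<in>Y. Z y) \<le> (\<Sum>y\<in>Y. card (Z y))"
    by (rule card_UN_le) fact
  also have "\<dots> \<le> card Y * L"
    using sum_bounded_above[of Y "\<lambda>y. card (Z y)" L] Z by simp
  also have "\<dots> \<le> L ^ Suc n"
    using mult_right_mono[OF Y(3), of L] by (simp add: mult.commute)
  finally have "card (\<Union>y\<in>Y. Z y) \<le> L ^ Suc n" .
  moreover have "mcball x r \<subseteq> (\<Union>z\<in>(\<Union>y\<in>Y. Z y). mcball z (r / 2 ^ Suc n))"
  proof
    fix w assume "w \<in> mcball x r"
    then obtain y where y: "y \<in> Y" "w \<in> mcball y (r / 2 ^ n)" using Y(4) by blast
    then obtain z where "z \<in> Z y" "w \<in> mcball z (r / 2 ^ n / 2)" using Z by blast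
    then show "w \<in> (\<Union>z\<in>(\<Union>y\<in>Y. Z y). mcball z (r / 2 ^ Suc n))"
      using y(1) by (auto simp: mult.commute)
  qed
  moreover have "(\<Union>y\<in>Y. Z y) \<subseteq> M" "finite (\<Union>y\<in>Y. Z y)"
    using Y(2) Z by (simp_all add: UN_subset_iff)
  ultimately show ?case by (intro exI[of _ "\<Union>y\<in>Y. Z y"] conjI)
qed

end

section \<open>Coordinates of product measures and normal mass of short intervals\<close>

text \<open>The joint law of the coordinates is the image of the product measure under the identity,
  hence the product of the marginals, which characterises independence.\<close>

lemma indep_vars_PiM_components:
  assumes I: "I \<noteq> {}" and M: "\<And>i. i \<in> I \<Longrightarrow> prob_space (M i)"
  shows "prob_space.indep_vars (PiM I M) M (\<lambda>i \<omega>. \<omega> i) I"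
proof -
  interpret P: prob_space "PiM I M"
    using M by (rule prob_space_PiM)
  have "distr (PiM I M) (PiM I M) (\<lambda>\<omega>. \<lambda>i\<in>I. \<omega> i) = distr (PiM I M) (PiM I M) (\<lambda>\<omega>. \<omega>)"
    by (rule distr_cong) (auto simp: space_PiM)
  also have "\<dots> = PiM I (\<lambda>i. distr (PiM I M) (M i) (\<lambda>\<omega>. \<omega> i))"
    by (simp only: distr_id, rule PiM_cong) (auto simp: distr_PiM_component M)
  finally show ?thesis
    using I by (subst P.indep_vars_iff_distr_eq_PiM') auto
qed

text \<open>The density never exceeds \<open>1 / (2 * \<sigma>)\<close>, because 2 pi is at least 4,
  and the interval has length \<open>2 * t\<close>.\<close>

lemma (in prob_space) prob_normal_abs_le:
  assumes X: "distributed M lborel X (normal_density \<mu> \<sigma>)" and \<sigma>: "\<sigma> > 0" and t: "t \<ge> 0"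
  shows "prob (X -` {-t..t} \<inter> space M) \<le> t / \<sigma>"
proof -
  have dens: "normal_density \<mu> \<sigma> x \<le> 1 / (2 * \<sigma>)" for x
  proof -
    have "2 * \<sigma> = sqrt (2\<^sup>2 * \<sigma>\<^sup>2)"
      using \<sigma> by (simp add: real_sqrt_mult)
    also have "\<dots> \<le> sqrt (2 * pi * \<sigma>\<^sup>2)"
      using pi_gt3 by (intro real_sqrt_le_mono mult_right_mono) auto
    finally have "1 / sqrt (2 * pi * \<sigma>\<^sup>2) \<le> 1 / (2 * \<sigma>)"
      using \<sigma> by (intro divide_left_mono) auto
    moreover have "exp (- (x - \<mu>)\<^sup>2 / (2 * \<sigma>\<^sup>2)) \<le> 1"
      by simp
    ultimately have "1 / sqrt (2 * pi * \<sigma>\<^sup>2) * exp (- (x - \<mu>)\<^sup>2 / (2 * \<sigma>\<^sup>2)) \<le> 1 / (2 * \<sigma>) * 1"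
      using \<sigma> by (intro mult_mono) auto
    then show ?thesis by (simp add: normal_density_def)
  qed
  have "emeasure M (X -` {-t..t} \<inter> space M) =
      (\<integral>\<^sup>+x. ennreal (normal_density \<mu> \<sigma> x) * indicator {-t..t} x \<partial>lborel)"
    by (rule distributed_emeasure[OF X]) auto
  also have "\<dots> \<le> (\<integral>\<^sup>+x. ennreal (1 / (2 * \<sigma>)) * indicator {-t..t} x \<partial>lborel)"
    using dens by (intro nn_integral_mono mult_right_mono) (auto intro: ennreal_leI)
  also have "\<dots> = ennreal (t / \<sigma>)"
    using t \<sigma> by (simp add: nn_integral_cmult ennreal_mult'[symmetric])
  finally show ?thesis
    using t \<sigma> by (simp add: emeasure_eq_measure)
qed

section \<open>Rows of a Gaussian matrix and small ball probabilities\<close>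

lemma prob_space_gaussian_matrix: "prob_space (gaussian_matrix k m)"
  unfolding gaussian_matrix_def by (rule prob_space_PiM) (rule prob_space_normal_density, simp)

lemma measurable_gaussian_matrix_entry [measurable]:
  assumes "i < k" "j < m"
  shows "(\<lambda>A. A (i, j)) \<in> borel_measurable (gaussian_matrix k m)"
proof -
  let ?N = "density lborel (\<lambda>x. ennreal (std_normal_density x))"
  have "(\<lambda>A. A (i, j)) \<in> PiM ({..<k} \<times> {..<m}) (\<lambda>_. ?N) \<rightarrow>\<^sub>M ?N"
    using assms by (intro measurable_component_singleton) auto
  then show ?thesis
    unfolding gaussian_matrix_def by (simp cong: measurable_cong_sets)
qed

lemma indep_vars_gaussian_matrix_entries:
  assumes "k \<ge> 1" "m \<ge> 1"
  shows "prob_space.indep_vars (gaussian_matrix k m) (\<lambda>_. borel) (\<lambda>ij A. A ij) ({..<k} \<times> {..<m})"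
proof -
  let ?N = "density lborel (\<lambda>x. ennreal (std_normal_density x))"
  interpret prob_space "gaussian_matrix k m" by (rule prob_space_gaussian_matrix)
  have "indep_vars (\<lambda>_. ?N) (\<lambda>ij A. A ij) ({..<k} \<times> {..<m})"
    using assms unfolding gaussian_matrix_def
    by (intro indep_vars_PiM_components) (auto simp: lessThan_empty_iff prob_space_normal_density)
  \<comment> \<open>Composing with the identity only replaces the target \<open>?N\<close> by
    \<open>borel\<close>, which has the same measurable sets.\<close>
  then show ?thesis
    by (rule indep_vars_compose2[where Y = "\<lambda>_ x. x"]) (auto simp: measurable_def)
qed

lemma distributed_gaussian_matrix_entry:
  assumes "i < k" "j < m"
  shows "distributed (gaussian_matrix k m) lborel (\<lambda>A. A (i, j)) std_normal_density"
proof -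
  let ?N = "density lborel (\<lambda>x. ennreal (std_normal_density x))"
  have "distr (gaussian_matrix k m) lborel (\<lambda>A. A (i, j)) = distr (gaussian_matrix k m) ?N (\<lambda>A. A (i, j))"
    by (rule distr_cong) auto
  also have "\<dots> = ?N"
    unfolding gaussian_matrix_def using assms
    by (intro distr_PiM_component) (auto simp: prob_space_normal_density)
  finally show ?thesis
    using assms by (auto simp: distributed_def)
qed

text \<open>A sum of independent centred normals is normal and the variances
  \<open>(v j)\<^sup>2\<close> add up to the squared norm of \<open>v\<close>.\<close>

lemma distributed_gaussian_matrix_row:
  assumes i: "i < k" and v: "\<exists>j<m. v j \<noteq> 0"
  shows "distributed (gaussian_matrix k m) lborel (\<lambda>A. \<Sum>j<m. A (i, j) * v j)
    (normal_density 0 (L2_set v {..<m}))"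
proof -
  interpret prob_space "gaussian_matrix k m" by (rule prob_space_gaussian_matrix)
  \<comment> \<open>Zero coefficients would give degenerate normals of deviation 0, so the sum is
    first taken over the support of \<open>v\<close>.\<close>
  define J where "J = {j\<in>{..<m}. v j \<noteq> 0}"
  have km: "k \<ge> 1" "m \<ge> 1" using i v by auto
  have "indep_vars (\<lambda>_. borel) (\<lambda>ij A. A ij) ({i} \<times> J)"
    by (rule indep_vars_subset[OF indep_vars_gaussian_matrix_entries[OF km]]) (use i in \<open>auto simp: J_def\<close>)
  then have ind: "indep_vars (\<lambda>_. borel) (\<lambda>ij A. v (snd ij) * A ij) ({i} \<times> J)"
    by (rule indep_vars_compose2[where Y = "\<lambda>ij x. v (snd ij) * x"]) auto
  have "distributed (gaussian_matrix k m) lborel (\<lambda>A. v (snd ij) * A ij) (normal_density 0 \<bar>v (snd ij)\<bar>)"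
    if "ij \<in> {i} \<times> J" for ij
    using that i normal_density_affine[OF distributed_gaussian_matrix_entry[of i k "snd ij" m], of "v (snd ij)" 0]
    by (auto simp: J_def)
  then have "distributed (gaussian_matrix k m) lborel (\<lambda>A. \<Sum>ij\<in>{i} \<times> J. v (snd ij) * A ij)
      (normal_density (\<Sum>ij\<in>{i} \<times> J. 0) (sqrt (\<Sum>ij\<in>{i} \<times> J. \<bar>v (snd ij)\<bar>\<^sup>2)))"
    using v by (intro sum_indep_normal ind) (auto simp: J_def)
  moreover have sum_J: "(\<Sum>ij\<in>{i} \<times> J. g ij) = (\<Sum>j\<in>J. g (i, j))" for g :: "nat \<times> nat \<Rightarrow> real"
  proof -
    have "{i} \<times> J = Pair i ` J" by auto
    then show ?thesis by (simp add: sum.reindex inj_on_def)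
  qed
  have "(\<Sum>ij\<in>{i} \<times> J. \<bar>v (snd ij)\<bar>\<^sup>2) = (\<Sum>j<m. (v j)\<^sup>2)"
    unfolding sum_J by (auto simp: J_def intro!: sum.mono_neutral_left)
  moreover have "(\<Sum>ij\<in>{i} \<times> J. v (snd ij) * A ij) = (\<Sum>j<m. A (i, j) * v j)" for A :: "nat \<times> nat \<Rightarrow> real"
    unfolding sum_J by (auto simp: J_def mult.commute intro!: sum.mono_neutral_left)
  ultimately show ?thesis
    by (simp add: L2_set_def)
qed

text \<open>The \<open>k\<close> coordinates of the image of \<open>v\<close> are independent, and
  each is normal with deviation at least \<open>s\<close>, so the one-dimensional bound
  \<open>t / s\<close> is raised to the power \<open>k\<close>.\<close>

lemma gaussian_matrix_small_ball:
  assumes k: "k \<ge> 1" and s: "0 < s" "s \<le> L2_set v {..<m}" and t: "t \<ge> 0"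
  defines "E \<equiv> {A \<in> space (gaussian_matrix k m). \<forall>i<k. \<bar>\<Sum>j<m. A (i, j) * v j\<bar> \<le> t}"
  shows "E \<in> sets (gaussian_matrix k m)" "measure (gaussian_matrix k m) E \<le> (t / s) ^ k"
proof -
  let ?G = "gaussian_matrix k m"
  interpret prob_space ?G by (rule prob_space_gaussian_matrix)
  define f where "f i A = (\<Sum>j<m. A (i, j) * v j)" for i :: nat and A :: "nat \<times> nat \<Rightarrow> real"
  have v: "\<exists>j<m. v j \<noteq> 0"
    using s L2_set_eq_0_iff[of "{..<m}" v] by auto
  then have m: "m \<ge> 1" by auto
  have f[measurable]: "f i \<in> borel_measurable ?G" if "i < k" for i
    unfolding f_def using that by measurable
  have E: "E = (\<Inter>i\<in>{..<k}. f i -` {-t..t} \<inter> space ?G)"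
    using k by (auto simp: E_def f_def abs_le_iff minus_le_iff lessThan_empty_iff)
  \<comment> \<open>Independence of the entries passes to disjoint blocks, here the rows;
    \<open>f i\<close> reads row \<open>i\<close> only.\<close>
  have "indep_vars (\<lambda>i. PiM ({i} \<times> {..<m}) (\<lambda>_. borel)) (\<lambda>i A. restrict A ({i} \<times> {..<m})) {..<k}"
    by (rule indep_vars_restrict[OF indep_vars_gaussian_matrix_entries[OF k m]])
      (auto simp: disjoint_family_on_def)
  then have "indep_vars (\<lambda>_. borel) (\<lambda>i A. f i (restrict A ({i} \<times> {..<m}))) {..<k}"
  proof (rule indep_vars_compose2)
    fix i
    show "f i \<in> borel_measurable (PiM ({i} \<times> {..<m}) (\<lambda>_. borel))"
      unfolding f_def
      by (intro borel_measurable_sum borel_measurable_times measurable_component_singleton) auto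
  qed
  moreover have "f i (restrict A ({i} \<times> {..<m})) = f i A" for i A
    by (simp add: f_def)
  ultimately have ind: "indep_vars (\<lambda>_. borel) f {..<k}"
    by simp
  show "E \<in> sets ?G"
    unfolding E using k by (intro sets.finite_INT) (auto simp: lessThan_empty_iff intro!: measurable_sets[OF f])
  have "prob E = (\<Prod>i<k. prob (f i -` {-t..t} \<inter> space ?G))"
    unfolding E using k by (intro indep_varsD_finite[OF ind]) (auto simp: lessThan_empty_iff)
  also have "\<dots> \<le> (\<Prod>i<k. t / s)"
  proof (intro prod_mono conjI)
    fix i assume "i \<in> {..<k}"
    then have "prob (f i -` {-t..t} \<inter> space ?G) \<le> t / L2_set v {..<m}"
      unfolding f_def using s t v by (intro prob_normal_abs_le[where \<mu> = 0] distributed_gaussian_matrix_row) auto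
    also have "\<dots> \<le> t / s"
      using s t by (intro divide_left_mono) auto
    finally show "prob (f i -` {-t..t} \<inter> space ?G) \<le> t / s" .
  qed auto
  finally show "prob E \<le> (t / s) ^ k" by simp
qed

section \<open>Union bound over the centres at ever finer scales\<close>

text \<open>Measurable covers stand in for measurability of \<open>B\<close>, which in the
  application comes from a union over an arbitrary set \<open>X\<close>. The intersection of covers
  of measure at most 1/(n+1) is a null set containing \<open>B\<close> within the space.\<close>

lemma (in finite_measure) AE_notin_if_small_covers:
  assumes "\<And>e. e > 0 \<Longrightarrow> \<exists>U\<in>sets M. B \<inter> space M \<subseteq> U \<and> measure M U \<le> e"
  shows "AE x in M. x \<notin> B"
proof -
  have "\<forall>n. \<exists>U\<in>sets M. B \<inter> space M \<subseteq> U \<and> measure M U \<le> inverse (real (Suc n))"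
    by (intro allI assms) simp
  then obtain U where U: "\<And>n. U n \<in> sets M" "\<And>n. B \<inter> space M \<subseteq> U n"
    "\<And>n. measure M (U n) \<le> inverse (real (Suc n))"
    by metis
  have "measure M (\<Inter>n. U n) \<le> inverse (real (Suc n))" for n
    by (rule order_trans[OF finite_measure_mono U(3)]) (use U(1) in auto)
  then have "measure M (\<Inter>n. U n) \<le> 0"
    by (intro LIMSEQ_le_const[OF LIMSEQ_inverse_real_of_nat]) auto
  then have "(\<Inter>n. U n) \<in> null_sets M"
    using U(1) by (auto simp: null_sets_def emeasure_eq_measure measure_le_0_iff)
  then show ?thesis
    by (rule AE_I') (use U(2) in auto)
qed

lemma abs_diff_le_eucl_dist:
  assumes "j < n"
  shows "\<bar>x j - y j\<bar> \<le> eucl_dist n x y"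
  using member_le_L2_set[of "{..<n}" j "\<lambda>i. \<bar>x i - y i\<bar>"] assms
  by (simp add: eucl_dist_def L2_set_def)

lemma AE_gaussian_matrix_no_kernel_in_annulus:
  assumes X: "X \<subseteq> Rn m" and k: "k \<ge> 1"
    and L: "Metric_space.half_covers X (eucl_dist m) L" "L < 2 ^ k"
    and x0: "x0 \<in> X" and R: "R > 0" and \<delta>: "\<delta> > 0" and K: "K \<ge> 0"
  shows "AE A in gaussian_matrix k m. \<not> ((\<forall>i<k. \<forall>j<m. \<bar>A (i, j)\<bar> \<le> K) \<and>
    (\<exists>y\<in>X. eucl_dist m x0 y \<le> R \<and> \<delta> \<le> eucl_dist m y p \<and>
      (\<forall>i<k. (\<Sum>j<m. A (i, j) * (y j - p j)) = 0)))"
proof -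
  let ?G = "gaussian_matrix k m"
  interpret prob_space ?G by (rule prob_space_gaussian_matrix)
  interpret Metric_space X "eucl_dist m" by (rule Metric_space_eucl_dist[OF X])
  define B where "B = {A. (\<forall>i<k. \<forall>j<m. \<bar>A (i, j)\<bar> \<le> K) \<and>
    (\<exists>y\<in>X. eucl_dist m x0 y \<le> R \<and> \<delta> \<le> eucl_dist m y p \<and>
      (\<forall>i<k. (\<Sum>j<m. A (i, j) * (y j - p j)) = 0))}"
  \<comment> \<open>At scale \<open>R / 2 ^ n\<close> each centre contributes at most
    \<open>Q / 2 ^ (n * k)\<close>. Multiplying by the \<open>L ^ n\<close> centres gives
    \<open>Q * q ^ n\<close>.\<close>
  define Q where "Q = (2 * real m * K * R / \<delta>) ^ k"
  define q where "q = real L / 2 ^ k"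
  have cover: "\<exists>U\<in>sets ?G. B \<inter> space ?G \<subseteq> U \<and> prob U \<le> Q * q ^ n"
    if n: "R / 2 ^ n \<le> \<delta> / 2" for n
  proof -
    \<comment> \<open>Bounds each entry of the image of \<open>c - y\<close>: \<open>m\<close>
      products of a matrix entry of size at most \<open>K\<close> and a coordinate of size at most
      \<open>R / 2 ^ n\<close>.\<close>
    define t where "t = real m * (K * (R / 2 ^ n))"
    have t: "t \<ge> 0" using K R by (simp add: t_def)
    obtain Y where Y: "Y \<subseteq> X" "finite Y" "card Y \<le> L ^ n"
      "mcball x0 R \<subseteq> (\<Union>y\<in>Y. mcball y (R / 2 ^ n))"
      using half_covers_iterate[OF L(1) x0 R, of n] by blast
    \<comment> \<open>The small ball bound needs centres away from \<open>p\<close>. A centre within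
      \<open>R / 2 ^ n \<le> \<delta> / 2\<close> of a point at distance at least \<delta> from
      \<open>p\<close> passes this filter.\<close>
    define Y' where "Y' = {c\<in>Y. \<delta> / 2 \<le> eucl_dist m c p}"
    define E where "E c = {A \<in> space ?G. \<forall>i<k. \<bar>\<Sum>j<m. A (i, j) * (c j - p j)\<bar> \<le> t}"
      for c :: "nat \<Rightarrow> real"
    have E: "E c \<in> sets ?G" "prob (E c) \<le> (t / (\<delta> / 2)) ^ k" if "c \<in> Y'" for c
      unfolding E_def using that t \<delta> k
      by (intro gaussian_matrix_small_ball[where s = "\<delta> / 2"]; simp add: Y'_def eucl_dist_def)+
    have fin: "finite Y'" using Y(2) by (simp add: Y'_def)
    have "B \<inter> space ?G \<subseteq> (\<Union>c\<in>Y'. E c)"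
    proof
      fix A assume "A \<in> B \<inter> space ?G"
      then obtain y where y: "y \<in> X" "eucl_dist m x0 y \<le> R" "\<delta> \<le> eucl_dist m y p"
        and Ay: "\<And>i. i < k \<Longrightarrow> (\<Sum>j<m. A (i, j) * (y j - p j)) = 0"
        and AK: "\<And>i j. i < k \<Longrightarrow> j < m \<Longrightarrow> \<bar>A (i, j)\<bar> \<le> K" and A: "A \<in> space ?G"
        by (auto simp: B_def)
      from y(1,2) x0 Y(4) obtain c where c: "c \<in> Y" "eucl_dist m c y \<le> R / 2 ^ n"
        by (force simp: mcball_def)
      have "eucl_dist m y p \<le> eucl_dist m c y + eucl_dist m c p"
        using L2_set_triangle_ineq[of "\<lambda>i. y i - c i" "\<lambda>i. c i - p i" "{..<m}"] commute[of c y]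
        by (simp add: eucl_dist_def)
      then have "\<delta> / 2 \<le> eucl_dist m c p" using c(2) y(3) n by linarith
      then have "c \<in> Y'" using c(1) by (simp add: Y'_def)
      moreover have "\<bar>\<Sum>j<m. A (i, j) * (c j - p j)\<bar> \<le> t" if "i < k" for i
      proof -
        \<comment> \<open>Subtracts the vanishing image of \<open>y - p\<close>.\<close>
        have "(\<Sum>j<m. A (i, j) * (c j - p j)) = (\<Sum>j<m. A (i, j) * (c j - y j))"
          using Ay[OF that] by (simp add: algebra_simps sum.distrib sum_subtractf)
        also have "\<bar>\<dots>\<bar> \<le> (\<Sum>j<m. \<bar>A (i, j)\<bar> * \<bar>c j - y j\<bar>)"
          by (rule order_trans[OF sum_abs]) (simp add: abs_mult)
        also have "\<dots> \<le> (\<Sum>j<m. K * (R / 2 ^ n))"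
          using AK[OF that] c(2) K abs_diff_le_eucl_dist[of _ m c y]
          by (intro sum_mono mult_mono) (auto intro: order_trans)
        finally show ?thesis by (simp add: t_def)
      qed
      ultimately show "A \<in> (\<Union>c\<in>Y'. E c)" using A by (auto simp: E_def)
    qed
    moreover have "(\<Union>c\<in>Y'. E c) \<in> sets ?G"
      using fin E(1) by (intro sets.finite_UN) auto
    moreover have "prob (\<Union>c\<in>Y'. E c) \<le> Q * q ^ n"
    proof -
      have "prob (\<Union>c\<in>Y'. E c) \<le> (\<Sum>c\<in>Y'. prob (E c))"
        using fin E(1) by (intro finite_measure_subadditive_finite) auto
      also have "\<dots> \<le> card Y' * (t / (\<delta> / 2)) ^ k"
        using E(2) by (intro sum_bounded_above) auto
      also have "\<dots> \<le> L ^ n * (t / (\<delta> / 2)) ^ k"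
      proof (intro mult_right_mono)
        have "card Y' \<le> L ^ n"
          using card_mono[of Y Y'] Y(2,3) by (force simp: Y'_def)
        then show "real (card Y') \<le> real (L ^ n)" by (rule of_nat_mono)
      qed (use t \<delta> in simp)
      also have "t / (\<delta> / 2) = (2 * real m * K * R / \<delta>) / 2 ^ n"
        by (simp add: t_def ac_simps)
      also have "real (L ^ n) * ((2 * real m * K * R / \<delta>) / 2 ^ n) ^ k = Q * q ^ n"
        by (simp add: Q_def q_def power_divide power_mult_distrib power_mult[symmetric] mult.commute)
      finally show ?thesis .
    qed
    ultimately show ?thesis by blast
  qed
  have "AE A in ?G. A \<notin> B"
  proof (rule AE_notin_if_small_covers)
    fix e :: real assume e: "e > 0"
    have "(\<lambda>n. R / 2 ^ n) \<longlonglongrightarrow> 0"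
      using tendsto_mult[OF tendsto_const[of R] LIMSEQ_power_zero[of "1 / 2 :: real"]]
      by (simp add: power_divide)
    then have 1: "\<forall>\<^sub>F n in sequentially. R / 2 ^ n < \<delta> / 2"
      by (rule order_tendstoD) (use \<delta> in simp)
    have "real L < 2 ^ k"
      \<comment> \<open>This is where \<open>L < 2 ^ k\<close> enters: it makes the ratio
        \<open>q\<close> less than 1.\<close>
      using L(2) of_nat_less_iff[where 'a=real, of L "2 ^ k"] by simp
    then have "norm q < 1"
      by (simp add: q_def)
    then have "(\<lambda>n. Q * q ^ n) \<longlonglongrightarrow> 0"
      using tendsto_mult[OF tendsto_const[of Q] LIMSEQ_power_zero[of q]] by simp
    then have 2: "\<forall>\<^sub>F n in sequentially. Q * q ^ n < e"
      by (rule order_tendstoD) fact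
    obtain n where n: "R / 2 ^ n < \<delta> / 2" "Q * q ^ n < e"
      using eventually_happens'[OF _ eventually_conj[OF 1 2]] by auto
    show "\<exists>U\<in>sets ?G. B \<inter> space ?G \<subseteq> U \<and> prob U \<le> e"
      using cover[OF less_imp_le[OF n(1)]] order_trans[OF _ less_imp_le[OF n(2)]] by blast
  qed
  then show ?thesis
    by (simp add: B_def)
qed

text \<open>The annulus statement is applied with all natural entry bounds \<open>a\<close>, radii
  \<open>b + 1\<close> and gaps 1/(c+1). These are countably many, and every bad matrix and point
  fall under one of them.\<close>

lemma AE_gaussian_matrix_notin_image:
  assumes X: "X \<subseteq> Rn m" and k: "k \<ge> 1"
    and L: "Metric_space.half_covers X (eucl_dist m) L" "L < 2 ^ k"
    and p: "p \<in> Rn m" "p \<notin> X"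
  shows "AE A in gaussian_matrix k m. mat_apply k m A p \<notin> mat_apply k m A ` X"
proof (cases "X = {}")
  case False
  then obtain x0 where x0: "x0 \<in> X" by blast
  \<comment> \<open>Since \<open>p\<close> lies outside \<open>X\<close>, positivity of its distance
    to \<open>y\<close> is taken from the metric on all of \<open>Rn m\<close>.\<close>
  interpret Rn: Metric_space "Rn m" "eucl_dist m" by (rule Metric_space_eucl_dist) simp
  have "AE A in gaussian_matrix k m. \<forall>a b c. \<not> ((\<forall>i<k. \<forall>j<m. \<bar>A (i, j)\<bar> \<le> real a) \<and>
    (\<exists>y\<in>X. eucl_dist m x0 y \<le> real (Suc b) \<and> inverse (real (Suc c)) \<le> eucl_dist m y p \<and>
      (\<forall>i<k. (\<Sum>j<m. A (i, j) * (y j - p j)) = 0)))"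
    unfolding AE_all_countable
    by (intro allI AE_gaussian_matrix_no_kernel_in_annulus[OF X k L x0]) auto
  then show ?thesis
  proof (eventually_elim, intro notI)
    fix A assume no: "\<forall>a b c. \<not> ((\<forall>i<k. \<forall>j<m. \<bar>A (i, j)\<bar> \<le> real a) \<and>
      (\<exists>y\<in>X. eucl_dist m x0 y \<le> real (Suc b) \<and> inverse (real (Suc c)) \<le> eucl_dist m y p \<and>
        (\<forall>i<k. (\<Sum>j<m. A (i, j) * (y j - p j)) = 0)))"
    assume "mat_apply k m A p \<in> mat_apply k m A ` X"
    then obtain y where y: "y \<in> X" "mat_apply k m A p = mat_apply k m A y" by blast
    have Ay: "(\<Sum>j<m. A (i, j) * (y j - p j)) = 0" if "i < k" for i
      using fun_cong[OF y(2), of i] that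
      by (simp add: mat_apply_def algebra_simps sum_subtractf)
    have "0 < eucl_dist m y p"
      using Rn.mdist_pos_eq[of y p] y(1) X p by auto
    then obtain c where c: "inverse (real (Suc c)) < eucl_dist m y p"
      using reals_Archimedean by blast
    obtain b where "eucl_dist m x0 y \<le> real b"
      using real_arch_simple by blast
    then have b: "eucl_dist m x0 y \<le> real (Suc b)" by simp
    \<comment> \<open>The sum of all absolute entries dominates each single one.\<close>
    obtain a where a: "(\<Sum>ij\<in>{..<k} \<times> {..<m}. \<bar>A ij\<bar>) \<le> real a"
      using real_arch_simple by blast
    have A_le: "\<bar>A (i, j)\<bar> \<le> real a" if "i < k" "j < m" for i j
      using member_le_sum[of "(i, j)" "{..<k} \<times> {..<m}" "\<lambda>ij. \<bar>A ij\<bar>"] that a by simp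
    show False
      using no[THEN spec[of _ a], THEN spec[of _ b], THEN spec[of _ c]]
      by (rule notE) (intro conjI bexI[of _ y] allI impI A_le b less_imp_le[OF c] Ay y(1))
  qed
qed simp

theorem theorem3p3:
  "\<exists>C::real. C > 0 \<and>
     (\<forall>(m::nat) (X::(nat \<Rightarrow> real) set) (p::nat \<Rightarrow> real) (k::nat) (L::nat).
        m \<ge> 1 \<longrightarrow> X \<subseteq> Rn m \<longrightarrow>
        Metric_space.doubling_constant X (eucl_dist m) = enat L \<longrightarrow>
        p \<in> Rn m \<longrightarrow> p \<notin> X \<longrightarrow>
        k \<ge> 1 \<longrightarrow> real k \<ge> C * log 2 (real L) \<longrightarrow>
        (AE A in gaussian_matrix k m. mat_apply k m A p \<notin> mat_apply k m A ` X))"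
proof (intro exI[of _ 2] conjI allI impI)
  fix m k L :: nat and X and p :: "nat \<Rightarrow> real"
  assume X: "X \<subseteq> Rn m" and dc: "Metric_space.doubling_constant X (eucl_dist m) = enat L"
    and p: "p \<in> Rn m" "p \<notin> X" and k: "k \<ge> 1" "2 * log 2 (real L) \<le> real k"
  \<comment> \<open>With the constant 2, the logarithm of \<open>L\<close> is at most
    \<open>k / 2\<close>, strictly below \<open>k\<close> as \<open>k \<ge> 1\<close>; the
    strictness also covers \<open>L = 1\<close>. The case \<open>L = 0\<close>, where the logarithm
    is meaningless, occurs only for empty \<open>X\<close>.\<close>
  have "L < 2 ^ k"
  proof (cases "L = 0")
    case False
    then have "real L = 2 powr log 2 (real L)" by simp
    also have "\<dots> < 2 powr real k" using k by simp
    finally have "real L < real (2 ^ k)" by (simp add: powr_realpow)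
    then show ?thesis by (simp only: of_nat_less_iff)
  qed simp
  moreover have "Metric_space.half_covers X (eucl_dist m) L"
    by (rule Metric_space.half_covers_doubling_constant[OF Metric_space_eucl_dist[OF X] dc])
  ultimately show "AE A in gaussian_matrix k m. mat_apply k m A p \<notin> mat_apply k m A ` X"
    using X k p by (intro AE_gaussian_matrix_notin_image)
qed simp

end
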